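(* Let $A=(a_{i,j})_{1\le i\le m,\,1\le j\le n}$ be an $m\times n$ matrix over a commutative ring with unity, $m\le n$, and let $1\le i\le m$. For $j\in N_n\setminus\{i\}$ let $\sigma_{i,j}$ be the sequence of length $n-1$ obtained from $(1,2,\dots,n)$ by deleting the entry $i$ and replacing the entry $j$ by $i$. Let $\tau_i$ be the sequence consisting of the elements of $N_m\setminus\{i\}$ in increasing order, followed by $i$, followed by $m+1,\dots,n$. Then $$R(x;z;A)=a_{i,i}\,x z\,R\big(x;z;A[N_m\setminus\{i\}\,|\,N_n\setminus\{i\}]\big)+\sum_{j\in N_n\setminus\{i\}}a_{i,j}\,x\,R\big(x;z;A[N_m\setminus\{i\}\,|\,\sigma_{i,j}]\big)+R\big(x;z;A[N_m\setminus\{i\}\,|\,\tau_i]\big).$$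
   Context: $N_n=\{1,\dots,n\}$. For $S\subseteq N_n$, $\mathrm{Inj}(S,N_n)$ is the set of injective maps $S\to N_n$; for $\varphi\in\mathrm{Inj}(S,N_n)$, $|\varphi|$ is the number of cycles of $\varphi$, i.e. the number of nonempty sets $C\subseteq S$ of the form $C=\{j,\varphi(j),\dots,\varphi^{p-1}(j)\}$ with $\varphi^p(j)=j$. For a $p\times q$ matrix $B=(b_{i,j})$, $p\le q$: $r_l(z;B)=\sum_{S\subseteq N_p,|S|=l}\sum_{\varphi\in\mathrm{Inj}(S,N_q)}z^{|\varphi|}\prod_{i\in S}b_{i,\varphi(i)}$ ($r_0=1$) and $R(x;z;B)=\sum_{l=0}^p r_l(z;B)x^l$ (equal to $1$ if $B$ has no rows). For a set $T$ of row indices and a sequence $(c_1,\dots,c_q)$ of column indices, $A[T\,|\,c_1,\dots,c_q]$ is the matrix formed by the rows of $A$ indexed by $T$ in increasing order, whose $s$-th column is column $c_s$ of $A$; it is re-indexed by $1,2,\dots$ in rows and columns before computing $R(x;z;\cdot)$. $A[T|N_n\setminus\{i\}]$ uses the columns of $N_n\setminus\{i\}$ in increasing order. *)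

theory Defs
  imports "Jordan_Normal_Form.Matrix" "HOL-Library.FuncSet"
begin

text \<open>
  Row and column indices start at 0, as usual for the type \<open>'a mat\<close>: the index set
  \<open>{1,...,n}\<close> is rendered as \<open>{..<n}\<close>. The sort \<open>{comm_ring, comm_monoid_mult}\<close> consists of
  the commutative rings with unity, without the requirement \<open>0 \<noteq> 1\<close> of \<open>comm_ring_1\<close>.
\<close>

definition Inj :: "nat set \<Rightarrow> nat set \<Rightarrow> (nat \<Rightarrow> nat) set" where
  "Inj S N = {\<phi> \<in> S \<rightarrow>\<^sub>E N. inj_on \<phi> S}"

text \<open>
  In the following definition \<open>C \<subseteq> S\<close> guarantees that \<open>\<phi>\<close> is only ever applied to elements
  of \<open>S\<close>, and \<open>C \<noteq> {}\<close> excludes \<open>p = 0\<close>.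
\<close>

definition cycles :: "nat set \<Rightarrow> (nat \<Rightarrow> nat) \<Rightarrow> nat set set" where
  "cycles S \<phi> = {C. C \<subseteq> S \<and> C \<noteq> {} \<and>
     (\<exists>j p. C = {(\<phi> ^^ k) j | k. k < p} \<and> (\<phi> ^^ p) j = j)}"

definition rook_coeff :: "nat \<Rightarrow> 'a \<Rightarrow> 'a mat \<Rightarrow> 'a::{comm_ring, comm_monoid_mult}" where
  "rook_coeff l z B =
     (\<Sum>S | S \<subseteq> {..<dim_row B} \<and> card S = l. \<Sum>\<phi>\<in>Inj S {..<dim_col B}.
        z ^ card (cycles S \<phi>) * (\<Prod>i\<in>S. B $$ (i, \<phi> i)))"

definition rook_poly :: "'a \<Rightarrow> 'a \<Rightarrow> 'a mat \<Rightarrow> 'a::{comm_ring, comm_monoid_mult}" where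
  "rook_poly x z B = (\<Sum>l=0..dim_row B. rook_coeff l z B * x ^ l)"

definition submat :: "'a mat \<Rightarrow> nat set \<Rightarrow> nat list \<Rightarrow> 'a mat" where
  "submat A T cs = mat (card T) (length cs) (\<lambda>(r, s). A $$ (sorted_list_of_set T ! r, cs ! s))"

definition sigma_seq :: "nat \<Rightarrow> nat \<Rightarrow> nat \<Rightarrow> nat list" where
  "sigma_seq n i j = map (\<lambda>c. if c = j then i else c) (removeAll i [0..<n])"

definition tau_seq :: "nat \<Rightarrow> nat \<Rightarrow> nat \<Rightarrow> nat list" where
  "tau_seq m n i = sorted_list_of_set ({..<m} - {i}) @ [i] @ [m..<n]"

lemma rook_coeff_0: "rook_coeff 0 z B = 1"
proof -
  have "{S. S \<subseteq> {..<dim_row B} \<and> card S = 0} = {{}}"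
    by (auto dest: finite_subset)
  moreover have "Inj {} N = {\<lambda>_. undefined}" for N
    by (auto simp: Inj_def)
  moreover have "cycles {} \<phi> = {}" for \<phi>
    by (auto simp: cycles_def)
  ultimately show ?thesis
    by (simp add: rook_coeff_def)
qed

lemma rook_poly_no_rows: "dim_row B = 0 \<Longrightarrow> rook_poly x z B = 1"
  by (simp add: rook_poly_def rook_coeff_0)

end

theory Submission
  imports Defs
begin

text \<open>
  The term of a partial injection \<open>\<phi>\<close> is sorted according to whether \<open>i\<close> lies outside its domain,
  is a fixed point, or is mapped to some \<open>j \<noteq> i\<close>. In the last case \<open>i\<close> is contracted: it is
  dropped from the domain, and the element mapped to \<open>i\<close>, if any, is mapped to \<open>j\<close> instead. Column
  \<open>j\<close> then has to carry the weights of column \<open>i\<close>, and a cycle through \<open>i\<close> keeps at least the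
  element \<open>j\<close>, so the number of cycles does not change. Cycles are handled throughout as the
  minimal nonempty sets closed under \<open>\<phi>\<close>, which avoids iterates of \<open>\<phi>\<close>.
\<close>

subsection \<open>Cycles as minimal closed sets\<close>

definition closed_sets :: "nat set \<Rightarrow> (nat \<Rightarrow> nat) \<Rightarrow> nat set set" where
  "closed_sets S \<phi> = {C. C \<subseteq> S \<and> C \<noteq> {} \<and> \<phi> ` C \<subseteq> C}"

text \<open>Formulated for an arbitrary family of sets, so that order isomorphisms between two such
  families can be applied to it.\<close>

definition minimal_sets :: "'b set set \<Rightarrow> 'b set set" where
  "minimal_sets P = {C \<in> P. \<forall>D\<in>P. D \<subseteq> C \<longrightarrow> D = C}"

lemma funpow_closed:
  assumes "\<phi> ` C \<subseteq> C" "j \<in> C"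
  shows "(\<phi> ^^ k) j \<in> C"
  using assms by (induction k) auto

text \<open>The orbit wraps around at \<open>p\<close>, so it is closed. A closed nonempty subset
  contains some \<open>(\<phi> ^^ k) j\<close>; \<open>p - k\<close> further steps lead back to
  \<open>j\<close>, and from there through the whole orbit.\<close>

lemma orbit_minimal_closed:
  assumes "C = {(\<phi> ^^ k) j | k. k < p}" "(\<phi> ^^ p) j = j" "C \<subseteq> S" "C \<noteq> {}"
  shows "C \<in> minimal_sets (closed_sets S \<phi>)"
proof -
  have p: "p > 0" using assms by auto
  have closed: "\<phi> ` C \<subseteq> C"
  proof
    fix y assume "y \<in> \<phi> ` C"
    then obtain k where k: "k < p" "y = \<phi> ((\<phi> ^^ k) j)" using assms(1) by auto
    show "y \<in> C"
    proof (cases "Suc k < p")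
      case True
      then show ?thesis using k assms(1) by (auto intro!: exI[of _ "Suc k"])
    next
      case False
      then have "Suc k = p" using k by simp
      then have "y = (\<phi> ^^ 0) j" using k assms(2) by auto
      then show ?thesis using p assms(1) by blast
    qed
  qed
  moreover have "D = C" if D: "D \<in> closed_sets S \<phi>" "D \<subseteq> C" for D
  proof -
    obtain d where d: "d \<in> D" using D(1) unfolding closed_sets_def by blast
    then obtain k where k: "k < p" "(\<phi> ^^ k) j \<in> D"
      using D(2) assms(1) by blast
    have "(\<phi> ^^ (p - k)) ((\<phi> ^^ k) j) \<in> D"
      using D k by (simp add: closed_sets_def funpow_closed)
    also have "(\<phi> ^^ (p - k)) ((\<phi> ^^ k) j) = (\<phi> ^^ (p - k + k)) j"
      by (simp only: funpow_add comp_apply)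
    finally have "j \<in> D" using k assms(2) by simp
    then have "(\<phi> ^^ k) j \<in> D" for k
      using D(1) by (intro funpow_closed) (auto simp: closed_sets_def)
    then have "C \<subseteq> D" unfolding assms(1) by blast
    with D(2) show ?thesis by (rule subset_antisym)
  qed
  ultimately show ?thesis using assms by (auto simp: minimal_sets_def closed_sets_def)
qed

text \<open>The forward iterates of any \<open>j\<close> in \<open>C\<close> form a closed subset,
  which by minimality is all of \<open>C\<close>. Hence \<open>j\<close> returns to itself, and its
  finite orbit is again closed and equal to \<open>C\<close>.\<close>

lemma minimal_closed_is_orbit:
  assumes "C \<in> minimal_sets (closed_sets S \<phi>)"
  shows "C \<in> cycles S \<phi>"
proof -
  have C: "C \<subseteq> S" "C \<noteq> {}" "\<phi> ` C \<subseteq> C"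
    and "\<forall>D\<in>closed_sets S \<phi>. D \<subseteq> C \<longrightarrow> D = C"
    using assms by (auto simp: minimal_sets_def closed_sets_def)
  then have min: "D = C" if "D \<subseteq> C" "D \<noteq> {}" "\<phi> ` D \<subseteq> D" for D
    using that by (simp add: closed_sets_def)
  obtain j where j: "j \<in> C" using C by blast
  \<comment> \<open>The iterates start at exponent 1, not 0: only then does membership of
    \<open>j\<close> yield a positive period.\<close>
  have "{(\<phi> ^^ Suc k) j | k. True} = C"
  proof (rule min)
    show "{(\<phi> ^^ Suc k) j | k. True} \<subseteq> C"
      using funpow_closed[OF C(3) j] by blast
    show "\<phi> ` {(\<phi> ^^ Suc k) j | k. True} \<subseteq> {(\<phi> ^^ Suc k) j | k. True}"
    proof clarify
      fix k
      have "\<phi> ((\<phi> ^^ Suc k) j) = (\<phi> ^^ Suc (Suc k)) j" by simp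
      then show "\<exists>k'. \<phi> ((\<phi> ^^ Suc k) j) = (\<phi> ^^ Suc k') j \<and> True" by blast
    qed
  qed auto
  with j have "j \<in> {(\<phi> ^^ Suc k) j | k. True}" by (simp only:)
  then have "\<exists>q. j = (\<phi> ^^ Suc q) j" by (simp only: mem_Collect_eq simp_thms)
  then obtain q where q: "(\<phi> ^^ Suc q) j = j" by (elim exE) (rule that, rule sym)
  define D where "D = {(\<phi> ^^ k) j | k. k < Suc q}"
  have D: "D \<subseteq> C" "D \<noteq> {}"
    unfolding D_def using funpow_closed[OF C(3) j] by blast+
  \<comment> \<open>Only the closedness of the orbit is taken from
    \<open>orbit_minimal_closed\<close>; equality with \<open>C\<close> then follows from the
    minimality of \<open>C\<close>.\<close>
  then have "D \<in> closed_sets S \<phi>"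
    using orbit_minimal_closed[OF D_def q] C by (auto simp: minimal_sets_def)
  then have "D = C" using D by (intro min) (auto simp: closed_sets_def)
  then show ?thesis using C q D_def unfolding cycles_def by blast
qed

lemma cycles_eq_minimal_closed: "cycles S \<phi> = minimal_sets (closed_sets S \<phi>)"
proof (intro subset_antisym subsetI)
  fix C assume "C \<in> cycles S \<phi>"
  then show "C \<in> minimal_sets (closed_sets S \<phi>)"
    unfolding cycles_def using orbit_minimal_closed by blast
qed (rule minimal_closed_is_orbit)

section \<open>Cycle counts under relabelling, adding a fixed point, and contraction\<close>

text \<open>Minimality is expressed by inclusion alone, so an order isomorphism maps minimal members
  onto minimal members. Cycle counts are compared below by giving such a map between families of
  closed sets.\<close>

lemma card_minimal_sets_eq:
  assumes bij: "bij_betw g P Q"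
    and mono: "\<And>C D. C \<in> P \<Longrightarrow> D \<in> P \<Longrightarrow> g C \<subseteq> g D \<longleftrightarrow> C \<subseteq> D"
  shows "card (minimal_sets P) = card (minimal_sets Q)"
proof -
  have Q: "Q = g ` P" and inj: "inj_on g P" using bij by (auto simp: bij_betw_def)
  have eq: "g D = g C \<longleftrightarrow> D = C" if "C \<in> P" "D \<in> P" for C D
    using that inj by (auto dest: inj_onD)
  have "g C \<in> minimal_sets Q \<longleftrightarrow> C \<in> minimal_sets P" if "C \<in> P" for C
    using that mono eq by (simp add: minimal_sets_def Q)
  then have "minimal_sets Q = g ` minimal_sets P"
    unfolding Q by (auto simp: minimal_sets_def)
  moreover have "inj_on g (minimal_sets P)"
    using inj by (rule inj_on_subset) (auto simp: minimal_sets_def)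
  ultimately show ?thesis by (simp add: card_image)
qed

lemma closed_sets_cong:
  assumes "\<And>k. k \<in> S \<Longrightarrow> \<phi> k = \<psi> k"
  shows "closed_sets S \<phi> = closed_sets S \<psi>"
proof -
  have "\<phi> ` C = \<psi> ` C" if "C \<subseteq> S" for C
    using that assms by (intro image_cong) auto
  then show ?thesis unfolding closed_sets_def by (intro Collect_cong conj_cong) simp_all
qed

text \<open>Conjugate maps have corresponding closed sets. As \<phi> may leave \<open>S\<close>,
  injectivity of \<open>f\<close> is required on a set \<open>N\<close> that also contains the
  values of \<phi>: otherwise a value outside a set \<open>C\<close> could be identified with a
  point of \<open>C\<close>.\<close>

lemma card_cycles_relabel:
  assumes inj: "inj_on f N" and "S \<subseteq> N" and "\<phi> ` S \<subseteq> N"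
    and conj: "\<And>k. k \<in> S \<Longrightarrow> \<psi> (f k) = f (\<phi> k)"
  shows "card (cycles (f ` S) \<psi>) = card (cycles S \<phi>)"
proof -
  have im: "f ` C \<subseteq> f ` D \<longleftrightarrow> C \<subseteq> D" if "C \<subseteq> N" "D \<subseteq> N" for C D
    using that inj unfolding inj_on_def by blast
  have conj_im: "\<psi> ` f ` C = f ` \<phi> ` C" if "C \<subseteq> S" for C
    using that conj by (force simp: image_iff)
  have closed: "\<psi> ` f ` C \<subseteq> f ` C \<longleftrightarrow> \<phi> ` C \<subseteq> C" if "C \<subseteq> S" for C
    unfolding conj_im[OF that] using that assms by (intro im) auto
  have "bij_betw ((`) f) (closed_sets S \<phi>) (closed_sets (f ` S) \<psi>)"
  proof (rule bij_betw_imageI)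
    show "inj_on ((`) f) (closed_sets S \<phi>)"
      using inj_on_image_Pow[OF inj]
      by (rule inj_on_subset) (use assms(2) in \<open>auto simp: closed_sets_def\<close>)
    show "(`) f ` closed_sets S \<phi> = closed_sets (f ` S) \<psi>"
    proof (intro subset_antisym subsetI)
      fix D assume D: "D \<in> closed_sets (f ` S) \<psi>"
      then obtain C where "C \<subseteq> S" "D = f ` C"
        by (auto simp: closed_sets_def subset_image_iff)
      then show "D \<in> (`) f ` closed_sets S \<phi>"
        using D closed by (auto simp: closed_sets_def)
    next
      fix D assume "D \<in> (`) f ` closed_sets S \<phi>"
      then obtain C where "C \<subseteq> S" "C \<noteq> {}" "\<phi> ` C \<subseteq> C" "D = f ` C"
        by (auto simp: closed_sets_def)
      then show "D \<in> closed_sets (f ` S) \<psi>"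
        using closed[of C] unfolding closed_sets_def by blast
    qed
  qed
  moreover have "f ` C \<subseteq> f ` D \<longleftrightarrow> C \<subseteq> D"
    if "C \<in> closed_sets S \<phi>" "D \<in> closed_sets S \<phi>" for C D
    using that assms(2) by (intro im) (auto simp: closed_sets_def)
  ultimately show ?thesis
    unfolding cycles_eq_minimal_closed by (metis card_minimal_sets_eq)
qed

lemma finite_cycles: "finite S \<Longrightarrow> finite (cycles S \<phi>)"
  by (rule finite_subset[of _ "Pow S"]) (auto simp: cycles_def)

text \<open>The set \<open>{i}\<close> is closed, so it is the only minimal closed set containing
  \<open>i\<close>. Closed sets avoiding \<open>i\<close> are exactly those over \<open>S\<close>,
  and so are all their subsets that are closed; minimality is therefore the same in both
  families.\<close>

lemma card_cycles_fixpoint: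
  assumes "finite S" "i \<notin> S" "\<phi> i = i" "\<And>k. k \<in> S \<Longrightarrow> \<phi> k = \<psi> k"
  shows "card (cycles (insert i S) \<phi>) = Suc (card (cycles S \<psi>))"
proof -
  have i: "{i} \<in> closed_sets (insert i S) \<phi>" using assms by (auto simp: closed_sets_def)
  have restr: "C \<in> closed_sets (insert i S) \<phi> \<and> i \<notin> C \<longleftrightarrow> C \<in> closed_sets S \<phi>" for C
    using assms(2) by (auto simp: closed_sets_def)
  have "minimal_sets (closed_sets (insert i S) \<phi>)
      = insert {i} (minimal_sets (closed_sets S \<phi>))" (is "?L = ?R")
  proof (rule Set.set_eqI)
    fix C
    show "C \<in> ?L \<longleftrightarrow> C \<in> ?R"
    proof (cases "i \<in> C")
      case True
      then have "C \<in> ?L \<longleftrightarrow> C = {i}"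
        using i unfolding minimal_sets_def by (auto simp: closed_sets_def)
      moreover have "C \<notin> minimal_sets (closed_sets S \<phi>)"
        using True restr by (auto simp: minimal_sets_def)
      ultimately show ?thesis by blast
    next
      case False
      then show ?thesis using restr unfolding minimal_sets_def by blast
    qed
  qed
  then have "cycles (insert i S) \<phi> = insert {i} (cycles S \<psi>)"
    using closed_sets_cong[of S \<phi> \<psi>] assms(4) by (simp add: cycles_eq_minimal_closed)
  moreover have "{i} \<notin> cycles S \<psi>" using assms(2) by (auto simp: cycles_def)
  ultimately show ?thesis using finite_cycles[OF assms(1)] by simp
qed

text \<open>Removing \<open>i\<close> is an order isomorphism between the two families of closed
  sets, because a set closed under \<phi> contains \<open>i\<close> exactly when it contains
  \<open>j\<close>. If \<open>j\<close> lies outside \<open>S\<close>, no such set contains either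
  of them.\<close>

lemma card_cycles_contract:
  assumes "finite S" "i \<notin> S" "j \<noteq> i" "\<phi> i = j"
    and inj: "inj_on \<phi> (insert i S)"
    and contr: "\<And>k. k \<in> S \<Longrightarrow> \<psi> k = (if \<phi> k = i then j else \<phi> k)"
  shows "card (cycles (insert i S) \<phi>) = card (cycles S \<psi>)"
proof -
  let ?P = "closed_sets (insert i S) \<phi>" and ?Q = "closed_sets S \<psi>"
  let ?expand = "\<lambda>D. if j \<in> D then insert i D else D"
  have iff: "i \<in> C \<longleftrightarrow> j \<in> C" if C: "C \<in> ?P" for C
  proof
    show "i \<in> C \<Longrightarrow> j \<in> C" using C assms(4) by (auto simp: closed_sets_def)
    assume j: "j \<in> C"
    \<comment> \<open>An injective self-map of the finite set \<open>C\<close> is onto, so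
      \<open>j\<close> has a preimage in \<open>C\<close>; by injectivity this preimage is
      \<open>i\<close>.\<close>
    have "inj_on \<phi> C"
      using inj by (rule inj_on_subset) (use C in \<open>auto simp: closed_sets_def\<close>)
    moreover have "finite C"
      using C assms(1) by (auto simp: closed_sets_def intro: finite_subset)
    ultimately have "\<phi> ` C = C"
      using C by (intro endo_inj_surj) (auto simp: closed_sets_def)
    with j have "j \<in> \<phi> ` C" by simp
    then obtain k where k: "k \<in> C" "\<phi> k = j" by blast
    have "k = i"
      by (rule inj_onD[OF inj]) (use k C assms(4) in \<open>auto simp: closed_sets_def\<close>)
    then show "i \<in> C" using k by simp
  qed
  have "bij_betw (\<lambda>C. C - {i}) ?P ?Q"
  proof (rule bij_betw_byWitness[where f' = ?expand])
    show "\<forall>C\<in>?P. ?expand (C - {i}) = C"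
      using iff assms(3) by auto
    show "\<forall>D\<in>?Q. ?expand D - {i} = D"
      using assms(2) by (auto simp: closed_sets_def)
    show "(\<lambda>C. C - {i}) ` ?P \<subseteq> ?Q"
    proof clarify
      fix C assume C: "C \<in> ?P"
      then have C': "C \<subseteq> insert i S" "C \<noteq> {}" "\<And>k. k \<in> C \<Longrightarrow> \<phi> k \<in> C"
        by (auto simp: closed_sets_def)
      \<comment> \<open>A closed set equal to \<open>{i}\<close> would also contain
        \<open>j\<close>, which differs from \<open>i\<close>.\<close>
      have "C - {i} \<noteq> {}" using C'(2) iff[OF C] assms(3) by blast
      moreover have "\<psi> k \<in> C - {i}" if "k \<in> C - {i}" for k
      proof -
        have "k \<in> S" using that C'(1) by blast
        then show ?thesis
          using contr[of k] C'(3)[of k] iff[OF C] assms(3) that by auto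
      qed
      ultimately show "C - {i} \<in> ?Q" using C'(1) by (auto simp: closed_sets_def)
    qed
    show "?expand ` ?Q \<subseteq> ?P"
    proof clarify
      fix D assume "D \<in> ?Q"
      then have D: "D \<subseteq> S" "D \<noteq> {}" "\<And>k. k \<in> D \<Longrightarrow> \<psi> k \<in> D"
        by (auto simp: closed_sets_def)
      have "\<phi> k \<in> ?expand D" if k: "k \<in> ?expand D" for k
      proof (cases "k \<in> D")
        case True
        then show ?thesis using D(3)[OF True] contr[of k] D(1) by (auto split: if_splits)
      next
        case False
        then have "k = i" "j \<in> D" using k by (auto split: if_splits)
        then show ?thesis using assms(4) by simp
      qed
      then have "\<phi> ` ?expand D \<subseteq> ?expand D" by blast
      moreover have "?expand D \<subseteq> insert i S" "?expand D \<noteq> {}" using D(1,2) by auto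
      ultimately show "?expand D \<in> ?P" unfolding closed_sets_def by blast
    qed
  qed
  moreover have "C - {i} \<subseteq> D - {i} \<longleftrightarrow> C \<subseteq> D" if "C \<in> ?P" "D \<in> ?P" for C D
    using iff[OF that(1)] iff[OF that(2)] assms(3) by blast
  ultimately show ?thesis
    unfolding cycles_eq_minimal_closed by (metis (lifting) card_minimal_sets_eq)
qed

subsection \<open>Rook polynomials over arbitrary index sets\<close>

text \<open>Rows and columns keep their original labels here, so that deleting an index does not
  renumber the others. The coefficients are merged into one sum over all domains.\<close>

definition rook_sum ::
    "'a \<Rightarrow> 'a \<Rightarrow> nat set \<Rightarrow> nat set \<Rightarrow> (nat \<Rightarrow> nat \<Rightarrow> 'a) \<Rightarrow> 'a::{comm_ring, comm_monoid_mult}" where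
  "rook_sum x z T N w =
     (\<Sum>S\<in>Pow T. \<Sum>\<phi>\<in>Inj S N. z ^ card (cycles S \<phi>) * (\<Prod>k\<in>S. w k (\<phi> k)) * x ^ card S)"

lemma rook_poly_eq_rook_sum:
  "rook_poly x z B = rook_sum x z {..<dim_row B} {..<dim_col B} (\<lambda>r c. B $$ (r, c))"
proof -
  let ?h = "\<lambda>S. \<Sum>\<phi>\<in>Inj S {..<dim_col B}.
    z ^ card (cycles S \<phi>) * (\<Prod>k\<in>S. B $$ (k, \<phi> k)) * x ^ card S"
  have "rook_poly x z B
      = (\<Sum>l\<in>{0..dim_row B}. \<Sum>S\<in>{S \<in> Pow {..<dim_row B}. card S = l}. ?h S)"
    unfolding rook_poly_def rook_coeff_def
    by (intro sum.cong refl) (auto simp: sum_distrib_right intro!: sum.cong)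
  also have "\<dots> = (\<Sum>S\<in>Pow {..<dim_row B}. ?h S)"
  proof (rule sum.group)
    show "card ` Pow {..<dim_row B} \<subseteq> {0..dim_row B}"
      using card_mono[of "{..<dim_row B}"] by fastforce
  qed auto
  finally show ?thesis by (simp add: rook_sum_def)
qed

lemma rook_sum_cong:
  assumes "\<And>k c. k \<in> T \<Longrightarrow> c \<in> N \<Longrightarrow> w k c = w' k c"
  shows "rook_sum x z T N w = rook_sum x z T N w'"
proof -
  have "(\<Prod>k\<in>S. w k (\<phi> k)) = (\<Prod>k\<in>S. w' k (\<phi> k))"
    if "S \<in> Pow T" "\<phi> \<in> Inj S N" for S \<phi>
    using that assms by (intro prod.cong) (auto simp: Inj_def)
  then show ?thesis unfolding rook_sum_def by (intro sum.cong refl) simp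
qed

text \<open>Rows and columns are renamed by the same \<open>f\<close>, since a cycle depends on
  which row labels coincide with column labels. The bijection of injections is conjugation by
  \<open>f\<close>, which preserves cycle counts by \<open>card_cycles_relabel\<close>.\<close>

lemma rook_sum_relabel:
  assumes inj: "inj_on f N" and "T \<subseteq> N"
  shows "rook_sum x z (f ` T) (f ` N) w = rook_sum x z T N (\<lambda>k c. w (f k) (f c))"
proof -
  let ?g = "inv_into N f"
  have gf: "?g (f k) = k" if "k \<in> N" for k
    using inj that by (rule inv_into_f_f)
  have gN: "?g c \<in> N" "f (?g c) = c" if "c \<in> f ` N" for c
    using that by (auto intro: inv_into_into f_inv_into_f)
  have inner: "(\<Sum>\<phi>\<in>Inj S N. z ^ card (cycles S \<phi>) * (\<Prod>k\<in>S. w (f k) (f (\<phi> k))) * x ^ card S)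
    = (\<Sum>\<psi>\<in>Inj (f ` S) (f ` N).
        z ^ card (cycles (f ` S) \<psi>) * (\<Prod>k\<in>f ` S. w k (\<psi> k)) * x ^ card (f ` S))"
    if S: "S \<subseteq> T" for S
  proof -
    have SN: "S \<subseteq> N" using S assms by auto
    have injS: "inj_on f S" using inj SN by (rule inj_on_subset)
    show ?thesis
    proof (rule sum.reindex_bij_witness
        [where j = "\<lambda>\<phi>. \<lambda>k\<in>f ` S. f (\<phi> (?g k))" and i = "\<lambda>\<psi>. \<lambda>k\<in>S. ?g (\<psi> (f k))"])
      fix \<phi> assume \<phi>: "\<phi> \<in> Inj S N"
      then have \<phi>N: "\<And>k. k \<in> S \<Longrightarrow> \<phi> k \<in> N" and \<phi>inj: "inj_on \<phi> S"
        and ext: "\<phi> \<in> extensional S"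
        by (auto simp: Inj_def PiE_def)
      let ?\<psi> = "\<lambda>k\<in>f ` S. f (\<phi> (?g k))"
      have \<psi>: "?\<psi> (f k) = f (\<phi> k)" if "k \<in> S" for k
        using that SN gf by auto
      show "(\<lambda>k\<in>S. ?g (?\<psi> (f k))) = \<phi>"
      proof (rule extensionalityI[OF _ ext])
        show "(\<lambda>k\<in>S. ?g (?\<psi> (f k))) k = \<phi> k" if "k \<in> S" for k
          using that \<psi>[OF that] gf[OF \<phi>N[OF that]] by simp
      qed simp
      have "inj_on ?\<psi> (f ` S)"
      proof (rule inj_onI, clarify)
        fix a b assume ab: "a \<in> S" "b \<in> S" "?\<psi> (f a) = ?\<psi> (f b)"
        then have "f (\<phi> a) = f (\<phi> b)" using \<psi> by simp
        then have "\<phi> a = \<phi> b" using inj \<phi>N ab by (auto dest: inj_onD)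
        then show "f a = f b" using \<phi>inj ab by (auto dest: inj_onD)
      qed
      then show "?\<psi> \<in> Inj (f ` S) (f ` N)"
        using \<phi>N SN gf by (auto simp: Inj_def)
      have "card (cycles (f ` S) ?\<psi>) = card (cycles S \<phi>)"
        using inj SN by (rule card_cycles_relabel) (use \<phi>N \<psi> in auto)
      moreover have "(\<Prod>k\<in>f ` S. w k (?\<psi> k)) = (\<Prod>k\<in>S. w (f k) (f (\<phi> k)))"
        using \<psi> by (subst prod.reindex[OF injS]) (auto intro!: prod.cong)
      ultimately show "z ^ card (cycles (f ` S) ?\<psi>) * (\<Prod>k\<in>f ` S. w k (?\<psi> k)) * x ^ card (f ` S)
          = z ^ card (cycles S \<phi>) * (\<Prod>k\<in>S. w (f k) (f (\<phi> k))) * x ^ card S"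
        using card_image[OF injS] by (simp only:)
    next
      fix \<psi> assume \<psi>: "\<psi> \<in> Inj (f ` S) (f ` N)"
      then have \<psi>N: "\<And>k. k \<in> S \<Longrightarrow> \<psi> (f k) \<in> f ` N" and \<psi>inj: "inj_on \<psi> (f ` S)"
        and ext: "\<psi> \<in> extensional (f ` S)"
        by (auto simp: Inj_def PiE_def)
      let ?\<phi> = "\<lambda>k\<in>S. ?g (\<psi> (f k))"
      show "(\<lambda>k\<in>f ` S. f (?\<phi> (?g k))) = \<psi>"
      proof (rule extensionalityI[OF _ ext])
        fix c assume "c \<in> f ` S"
        then obtain k where k: "k \<in> S" "c = f k" by blast
        then have "?g c = k" using SN gf by blast
        then show "(\<lambda>k\<in>f ` S. f (?\<phi> (?g k))) c = \<psi> c"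
          using k gN(2)[OF \<psi>N[OF k(1)]] by auto
      qed simp
      have "inj_on ?\<phi> S"
      proof (rule inj_onI)
        fix a b assume ab: "a \<in> S" "b \<in> S" "?\<phi> a = ?\<phi> b"
        then have "?g (\<psi> (f a)) = ?g (\<psi> (f b))" by simp
        then have "\<psi> (f a) = \<psi> (f b)" using gN(2) \<psi>N ab by metis
        then have "f a = f b" using \<psi>inj ab by (auto dest: inj_onD)
        then show "a = b" using injS ab by (auto dest: inj_onD)
      qed
      then show "?\<phi> \<in> Inj S N" using \<psi>N gN(1) by (auto simp: Inj_def)
    qed
  qed
  \<comment> \<open>The inner sums agree for each domain \<open>S\<close>; it remains to reindex the
    outer sum by taking images under \<open>f\<close>.\<close>
  have "inj_on ((`) f) (Pow T)"
    using inj assms(2) by (meson inj_on_image_Pow inj_on_subset)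
  then have "rook_sum x z (f ` T) (f ` N) w = (\<Sum>S\<in>Pow T. \<Sum>\<psi>\<in>Inj (f ` S) (f ` N).
        z ^ card (cycles (f ` S) \<psi>) * (\<Prod>k\<in>f ` S. w k (\<psi> k)) * x ^ card (f ` S))"
    unfolding rook_sum_def image_Pow_surj[OF refl, symmetric]
    by (subst sum.reindex) auto
  also have "\<dots> = rook_sum x z T N (\<lambda>k c. w (f k) (f c))"
    unfolding rook_sum_def by (intro sum.cong refl inner[symmetric]) auto
  finally show ?thesis .
qed

section \<open>Splitting off the index \<open>i\<close>\<close>

text \<open>For \<open>j = i\<close> the substitution of \<open>i\<close> for \<open>j\<close> is the identity, so that fixing and contracting
  \<open>i\<close> are instances of the same bijection.\<close>

lemma sum_Inj_insert:
  assumes "i \<notin> S" "i \<in> N"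
  shows "(\<Sum>\<phi>\<in>Inj (insert i S) N. h \<phi>)
    = (\<Sum>j\<in>N. \<Sum>\<psi>\<in>Inj S (N - {i}). h ((\<lambda>k\<in>S. if \<psi> k = j then i else \<psi> k)(i := j)))"
proof -
  let ?E = "\<lambda>(j, \<psi>). (\<lambda>k\<in>S. if \<psi> k = j then i else \<psi> k)(i := j)"
  let ?C = "\<lambda>\<phi>. (\<phi> i, \<lambda>k\<in>S. if \<phi> k = i then \<phi> i else \<phi> k)"
  have "(\<Sum>\<phi>\<in>Inj (insert i S) N. h \<phi>) = (\<Sum>p\<in>N \<times> Inj S (N - {i}). h (?E p))"
  proof (rule sum.reindex_bij_witness[where i = ?E and j = ?C])
    fix \<phi> assume "\<phi> \<in> Inj (insert i S) N"
    then have \<phi>: "\<And>k. k \<in> insert i S \<Longrightarrow> \<phi> k \<in> N" "inj_on \<phi> (insert i S)"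
      "\<And>k. k \<notin> insert i S \<Longrightarrow> \<phi> k = undefined"
      by (auto simp: Inj_def PiE_def extensional_def)
    \<comment> \<open>Before contraction no element of \<open>S\<close> has the value
      \<open>\<phi> i\<close>. Hence afterwards only the former preimage of \<open>i\<close> has it,
      which makes the substitution reversible.\<close>
    have ne: "\<phi> k \<noteq> \<phi> i" if "k \<in> S" for k
      using \<phi>(2) that assms(1) by (auto simp: inj_on_def)
    show *: "?E (?C \<phi>) = \<phi>"
      using \<phi>(3) ne by (auto simp: fun_eq_iff)
    then show "h (?E (?C \<phi>)) = h \<phi>" by simp
    have "inj_on (\<lambda>k\<in>S. if \<phi> k = i then \<phi> i else \<phi> k) S"
      using \<phi>(2) ne by (auto simp: inj_on_def)
    moreover have "(if \<phi> k = i then \<phi> i else \<phi> k) \<in> N - {i}" if "k \<in> S" for k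
      using \<phi>(1) ne[OF that] that by auto
    ultimately show "?C \<phi> \<in> N \<times> Inj S (N - {i})"
      using \<phi>(1) by (auto simp: Inj_def)
  next
    fix p assume "p \<in> N \<times> Inj S (N - {i})"
    then obtain j \<psi> where p: "p = (j, \<psi>)" "j \<in> N" "\<psi> \<in> Inj S (N - {i})" by blast
    then have \<psi>: "\<And>k. k \<in> S \<Longrightarrow> \<psi> k \<in> N" "\<And>k. k \<in> S \<Longrightarrow> \<psi> k \<noteq> i" "inj_on \<psi> S"
      "\<And>k. k \<notin> S \<Longrightarrow> \<psi> k = undefined"
      by (auto simp: Inj_def PiE_def extensional_def)
    show "?C (?E p) = p"
      using p(1) \<psi> assms(1) by (auto simp: fun_eq_iff)
    have "inj_on (?E p) (insert i S)"
      using p(1) \<psi>(2,3) assms(1) by (auto simp: inj_on_def)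
    moreover have "?E p \<in> insert i S \<rightarrow>\<^sub>E N"
      using p(1,2) \<psi>(1,4) assms(2) by (auto simp: PiE_def extensional_def)
    ultimately show "?E p \<in> Inj (insert i S) N" by (simp add: Inj_def)
  qed
  then show ?thesis by (simp add: sum.cartesian_product split_def)
qed

text \<open>For \<open>j = i\<close> the extension adds the cycle \<open>{i}\<close>. Otherwise,
  since \<psi> avoids the value \<open>i\<close>, contracting \<open>i\<close> in the extension
  gives back \<psi>.\<close>

lemma card_cycles_extend:
  assumes "finite S" "i \<notin> S" "\<psi> \<in> Inj S (N - {i})"
  shows "card (cycles (insert i S) ((\<lambda>k\<in>S. if \<psi> k = j then i else \<psi> k)(i := j)))
    = (if j = i then Suc (card (cycles S \<psi>)) else card (cycles S \<psi>))"
proof (cases "j = i")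
  case True
  have "card (cycles (insert i S) ((\<lambda>k\<in>S. if \<psi> k = j then i else \<psi> k)(i := j)))
      = Suc (card (cycles S \<psi>))"
    using assms(1,2) by (rule card_cycles_fixpoint) (use True assms(2) in auto)
  then show ?thesis using True by simp
next
  case False
  have \<psi>: "\<And>k. k \<in> S \<Longrightarrow> \<psi> k \<noteq> i" "inj_on \<psi> S"
    using assms(3) by (auto simp: Inj_def)
  have "card (cycles (insert i S) ((\<lambda>k\<in>S. if \<psi> k = j then i else \<psi> k)(i := j)))
      = card (cycles S \<psi>)"
    using assms(1,2) False
  proof (rule card_cycles_contract)
    show "inj_on ((\<lambda>k\<in>S. if \<psi> k = j then i else \<psi> k)(i := j)) (insert i S)"
      using \<psi> assms(2) by (auto simp: inj_on_def)
  qed (use \<psi>(1) assms(2) in auto)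
  then show ?thesis using False by simp
qed

theorem rook_sum_expand:
  assumes "finite N" "T \<subseteq> N" "i \<in> T"
  shows "rook_sum x z T N w =
      w i i * x * z * rook_sum x z (T - {i}) (N - {i}) w
    + (\<Sum>j\<in>N - {i}. w i j * x *
         rook_sum x z (T - {i}) (N - {i}) (\<lambda>k c. w k (if c = j then i else c)))
    + rook_sum x z (T - {i}) N w"
proof -
  let ?T = "T - {i}"
  let ?t = "\<lambda>j c. if c = j then i else c"
  let ?h = "\<lambda>S \<phi>. z ^ card (cycles S \<phi>) * (\<Prod>k\<in>S. w k (\<phi> k)) * x ^ card S"
  \<comment> \<open>The factor for the additional cycle \<open>{i}\<close>, which arises only when
    \<open>i\<close> is fixed.\<close>
  let ?e = "\<lambda>j. if j = i then z else 1"
  have finT: "finite T" and iN: "i \<in> N" using assms by (auto intro: finite_subset)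
  have term_eq: "?h (insert i S) ((\<lambda>k\<in>S. ?t j (\<psi> k))(i := j))
      = w i j * x * ?e j *
          (z ^ card (cycles S \<psi>) * (\<Prod>k\<in>S. w k (?t j (\<psi> k))) * x ^ card S)"
    if "S \<in> Pow ?T" "\<psi> \<in> Inj S (N - {i})" for S j \<psi>
  proof -
    have S: "finite S" "i \<notin> S" using that finT by (auto intro: finite_subset)
    have "(\<Prod>k\<in>S. w k (((\<lambda>k\<in>S. ?t j (\<psi> k))(i := j)) k)) = (\<Prod>k\<in>S. w k (?t j (\<psi> k)))"
      using S(2) by (intro prod.cong refl) auto
    then show ?thesis
      using S card_cycles_extend[OF S that(2), of j] by (simp add: ac_simps)
  qed
  \<comment> \<open>Domains without \<open>i\<close> may still use \<open>i\<close> as a value, so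
    their part keeps all of \<open>N\<close> and is the last summand. In the others \<open>i\<close>
    is contracted and disappears from rows and columns.\<close>
  have "Pow T = Pow ?T \<union> insert i ` Pow ?T"
    using Pow_insert[of i ?T] assms(3) by (simp add: insert_absorb)
  then have "rook_sum x z T N w
      = (\<Sum>S\<in>Pow ?T \<union> insert i ` Pow ?T. \<Sum>\<phi>\<in>Inj S N. ?h S \<phi>)"
    by (simp add: rook_sum_def)
  also have "\<dots> = (\<Sum>S\<in>Pow ?T. \<Sum>\<phi>\<in>Inj S N. ?h S \<phi>)
      + (\<Sum>S\<in>insert i ` Pow ?T. \<Sum>\<phi>\<in>Inj S N. ?h S \<phi>)"
    using finT by (intro sum.union_disjoint) auto
  also have "(\<Sum>S\<in>insert i ` Pow ?T. \<Sum>\<phi>\<in>Inj S N. ?h S \<phi>)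
      = (\<Sum>S\<in>Pow ?T. \<Sum>\<phi>\<in>Inj (insert i S) N. ?h (insert i S) \<phi>)"
    by (subst sum.reindex) (auto simp: inj_on_def)
  also have "\<dots> = (\<Sum>S\<in>Pow ?T. \<Sum>j\<in>N. \<Sum>\<psi>\<in>Inj S (N - {i}). w i j * x * ?e j *
      (z ^ card (cycles S \<psi>) * (\<Prod>k\<in>S. w k (?t j (\<psi> k))) * x ^ card S))"
  proof (intro sum.cong refl)
    fix S assume S: "S \<in> Pow ?T"
    then have "i \<notin> S" by blast
    then have "(\<Sum>\<phi>\<in>Inj (insert i S) N. ?h (insert i S) \<phi>)
        = (\<Sum>j\<in>N. \<Sum>\<psi>\<in>Inj S (N - {i}). ?h (insert i S) ((\<lambda>k\<in>S. ?t j (\<psi> k))(i := j)))"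
      using iN by (rule sum_Inj_insert)
    also have "\<dots> = (\<Sum>j\<in>N. \<Sum>\<psi>\<in>Inj S (N - {i}). w i j * x * ?e j *
        (z ^ card (cycles S \<psi>) * (\<Prod>k\<in>S. w k (?t j (\<psi> k))) * x ^ card S))"
      using S by (intro sum.cong refl term_eq)
    finally show "(\<Sum>\<phi>\<in>Inj (insert i S) N. ?h (insert i S) \<phi>) = \<dots>" .
  qed
  \<comment> \<open>With \<open>j\<close> outermost, the remaining double sum is a rook sum in which
    column \<open>j\<close> carries the weights of column \<open>i\<close>.\<close>
  also have "\<dots> = (\<Sum>j\<in>N. w i j * x * ?e j *
      rook_sum x z ?T (N - {i}) (\<lambda>k c. w k (?t j c)))"
    by (subst sum.swap) (simp add: rook_sum_def sum_distrib_left)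
  also have "\<dots> = w i i * x * z * rook_sum x z ?T (N - {i}) (\<lambda>k c. w k (?t i c))
      + (\<Sum>j\<in>N - {i}. w i j * x * rook_sum x z ?T (N - {i}) (\<lambda>k c. w k (?t j c)))"
    using assms(1) iN by (subst sum.remove[of _ i]) (auto intro!: sum.cong)
  also have "rook_sum x z ?T (N - {i}) (\<lambda>k c. w k (?t i c)) = rook_sum x z ?T (N - {i}) w"
    by (rule rook_sum_cong) auto
  finally show ?thesis by (simp add: rook_sum_def ac_simps)
qed

subsection \<open>Submatrices\<close>

text \<open>The list \<open>xs\<close> labels the column positions, while \<open>t\<close> tells
  which column of \<open>A\<close> is read at each label. As \<open>xs\<close> starts with the row
  labels in increasing order, the \<open>r\<close>-th row and the \<open>r\<close>-th column have
  the same label, so positional cycles become cycles of labels.\<close>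

lemma rook_poly_submat:
  assumes "finite T" "distinct xs" "xs = sorted_list_of_set T @ ys"
  shows "rook_poly x z (submat A T (map t xs)) = rook_sum x z T (set xs) (\<lambda>k c. A $$ (k, t c))"
proof -
  have len: "card T \<le> length xs" using assms(3) by simp
  have nth_row: "sorted_list_of_set T ! r = xs ! r" if "r < card T" for r
    using that assms(3) by (simp add: nth_append)
  have T: "T = (!) xs ` {..<card T}"
  proof -
    have "T = set (sorted_list_of_set T)" using assms(1) by simp
    also have "\<dots> = (!) (sorted_list_of_set T) ` {..<card T}"
      by (auto simp: set_conv_nth)
    also have "\<dots> = (!) xs ` {..<card T}" using nth_row by (intro image_cong) auto
    finally show ?thesis .
  qed
  have N: "set xs = (!) xs ` {..<length xs}" by (auto simp: set_conv_nth)
  have "rook_poly x z (submat A T (map t xs))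
      = rook_sum x z {..<card T} {..<length xs} (\<lambda>r s. A $$ (xs ! r, t (xs ! s)))"
    unfolding rook_poly_eq_rook_sum
    by (auto simp: submat_def nth_row intro!: rook_sum_cong)
  also have "\<dots> = rook_sum x z ((!) xs ` {..<card T}) ((!) xs ` {..<length xs})
      (\<lambda>k c. A $$ (k, t c))"
    using len assms(2) by (subst rook_sum_relabel) (auto simp: inj_on_nth)
  also have "\<dots> = rook_sum x z T (set xs) (\<lambda>k c. A $$ (k, t c))"
    using T N by simp
  finally show ?thesis .
qed

lemma sorted_list_of_set_lessThan_remove:
  "sorted_list_of_set ({..<n} - {i}) = removeAll i [0..<n]"
proof (rule sorted_distinct_set_unique)
  show "set (sorted_list_of_set ({..<n} - {i})) = set (removeAll i [0..<n])" by auto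
qed (simp_all add: removeAll_filter_not_eq sorted_wrt_filter distinct_filter)

section \<open>The recurrence for matrices\<close>

theorem theorem3:
  fixes A :: "'a::{comm_ring, comm_monoid_mult} mat" and x z :: 'a and m n i :: nat
  assumes "A \<in> carrier_mat m n" and "m \<le> n" and "i < m"
  shows "rook_poly x z A =
      A $$ (i, i) * x * z * rook_poly x z
        (submat A ({..<m} - {i}) (sorted_list_of_set ({..<n} - {i})))
    + (\<Sum>j\<in>{..<n} - {i}. A $$ (i, j) * x * rook_poly x z
        (submat A ({..<m} - {i}) (sigma_seq n i j)))
    + rook_poly x z (submat A ({..<m} - {i}) (tau_seq m n i))"
proof -
  let ?T = "{..<m} - {i}" and ?N = "{..<n} - {i}"
  let ?xs = "sorted_list_of_set ?N"
  have "[0..<n] = [0..<m] @ [m..<n]"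
    using upt_add_eq_append[of 0 m "n - m"] assms(2) by simp
  \<comment> \<open>Because \<open>i < m\<close>, deleting \<open>i\<close> affects only the initial
    segment; the column labels thus begin with the row labels.\<close>
  then have xs: "?xs = sorted_list_of_set ?T @ [m..<n]"
    using assms(3) by (simp add: sorted_list_of_set_lessThan_remove)
  \<comment> \<open>The identity as \<open>t\<close> gives the minor of the first summand, and the
    substitution of \<open>i\<close> for \<open>j\<close> gives
    \<open>sigma_seq n i j\<close>.\<close>
  have minor: "rook_poly x z (submat A ?T (map t ?xs))
      = rook_sum x z ?T ?N (\<lambda>k c. A $$ (k, t c))" for t
    using rook_poly_submat[OF _ _ xs, of x z A t] by simp
  \<comment> \<open>In \<open>tau_seq\<close> the column \<open>i\<close> is moved behind the row
    labels, so the remaining rows still match the first columns although no column is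
    deleted.\<close>
  have "rook_poly x z (submat A ?T (map (\<lambda>c. c) (tau_seq m n i)))
      = rook_sum x z ?T (set (tau_seq m n i)) (\<lambda>k c. A $$ (k, c))"
    using assms(3) by (intro rook_poly_submat[where ys = "i # [m..<n]"]) (auto simp: tau_seq_def)
  moreover have "set (tau_seq m n i) = {..<n}"
    using assms(2,3) by (auto simp: tau_seq_def)
  ultimately have tau: "rook_poly x z (submat A ?T (tau_seq m n i))
      = rook_sum x z ?T {..<n} (\<lambda>k c. A $$ (k, c))"
    by simp
  have "rook_poly x z A = rook_sum x z {..<m} {..<n} (\<lambda>k c. A $$ (k, c))"
    using assms(1) by (simp add: rook_poly_eq_rook_sum)
  also have "\<dots> = A $$ (i, i) * x * z * rook_sum x z ?T ?N (\<lambda>k c. A $$ (k, c))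
    + (\<Sum>j\<in>?N. A $$ (i, j) * x *
         rook_sum x z ?T ?N (\<lambda>k c. A $$ (k, if c = j then i else c)))
    + rook_sum x z ?T {..<n} (\<lambda>k c. A $$ (k, c))"
    using assms(2,3) by (intro rook_sum_expand) auto
  finally show ?thesis
    using minor[of "\<lambda>c. c"] minor[of "\<lambda>c. if c = j then i else c" for j] tau
    by (simp add: sigma_seq_def sorted_list_of_set_lessThan_remove)
qed

end
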